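(* Let $p_1,\ldots,p_k$ be distinct odd primes and $l_1,\ldots,l_k$ positive integers such that each $p_i^{l_i}$ is an overpseudoprime to base 2 and $h(p_1)=h(p_2)=\cdots=h(p_k)$. Then $n=p_1^{l_1}\cdots p_k^{l_k}$ is an overpseudoprime to base 2.
   Context: For an odd integer $m>1$, $h(m)$ denotes the multiplicative order of 2 modulo $m$. The cyclotomic cosets of 2 modulo $m$ are the orbits of $\{1,2,\ldots,m-1\}$ under $x\mapsto 2x \bmod m$; $r(m)$ is their number. An odd composite number $n$ is called an overpseudoprime to base 2 if $n=r(n)h(n)+1$. *)

theory Defs
  imports "HOL-Number_Theory.Number_Theory" "HOL-Combinatorics.Orbits"
begin

text \<open>
  In the library \<open>orbit f x\<close> consists of the iterates \<open>(f ^^ n) x\<close> with \<open>n > 0\<close>.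
  For odd \<open>m\<close> doubling permutes the residues modulo \<open>m\<close>, so each \<open>x\<close> lies in its own orbit
  (see \<open>cyclotomic_coset_eq\<close> below) and these are the usual cosets
  \<open>{x, 2x, 4x, \<dots>}\<close> modulo \<open>m\<close>.
\<close>

definition cyclotomic_cosets :: "nat \<Rightarrow> nat set set" where
  "cyclotomic_cosets m = (\<lambda>x. orbit (\<lambda>y. 2 * y mod m) x) ` {1..m - 1}"

definition r :: "nat \<Rightarrow> nat" where
  "r m = card (cyclotomic_cosets m)"

definition h :: "nat \<Rightarrow> nat" where
  "h m = ord m 2"

definition overpseudoprime :: "nat \<Rightarrow> bool" where
  "overpseudoprime n \<longleftrightarrow> odd n \<and> n > 1 \<and> \<not> prime n \<and> n = r n * h n + 1"

lemma funpow_double_mod: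
  "x < m \<Longrightarrow> ((\<lambda>y. 2 * y mod m) ^^ i) x = 2 ^ i * x mod m" for m :: nat
  by (induction i) (auto simp: mod_mult_right_eq mult.assoc)

lemma cyclotomic_coset_eq:
  fixes m x :: nat
  assumes "odd m" "x < m"
  shows "orbit (\<lambda>y. 2 * y mod m) x = {2 ^ i * x mod m | i. True}"
proof -
  have "\<exists>j>0. 2 ^ i * x mod m = 2 ^ j * x mod m" for i
  proof (intro exI conjI)
    have "[2 ^ ord m 2 = 1] (mod m)"
      by (rule ord)
    then have "[2 ^ ord m 2 * (2 ^ i * x) = 1 * (2 ^ i * x)] (mod m)"
      by (rule cong_mult) simp
    then show "2 ^ i * x mod m = 2 ^ (ord m 2 + i) * x mod m"
      by (simp add: cong_def power_add mult.assoc)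
    have "ord m 2 > 0"
      using assms by (simp add: ord_eq_0 coprime_commute)
    then show "ord m 2 + i > 0" by simp
  qed
  then show ?thesis
    unfolding orbit_altdef using funpow_double_mod[OF assms(2)] by auto
qed

end

theory Submission
  imports Defs
begin

text \<open>
  The coset of \<open>x\<close> modulo \<open>m\<close> has \<open>h (m / gcd x m)\<close> elements, which divides \<open>h m\<close>. As the cosets
  partition \<open>{1..m - 1}\<close>, the equation \<open>m = r m * h m + 1\<close> says that all of them have the maximal
  size \<open>h m\<close>, that is, \<open>h d = h m\<close> for every divisor \<open>d > 1\<close> of \<open>m\<close>. So let \<open>H\<close> be the common value
  of \<open>h (p\<^sub>i)\<close>. Every prime power \<open>p\<^sub>i ^ l\<^sub>i\<close> divides \<open>2 ^ H - 1\<close>, hence so does \<open>n\<close>; and a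
  divisor \<open>d > 1\<close> of \<open>n\<close> has some prime factor \<open>p\<^sub>i\<close>, so that \<open>H\<close> divides \<open>h d\<close>.
\<close>

lemma ord_dvd_mono:
  fixes d m a :: nat
  assumes "d dvd m"
  shows "ord d a dvd ord m a"
  using cong_dvd_modulus_nat[OF ord assms] by (simp only: ord_divides[symmetric])

text \<open>Dividing \<open>x\<close> and \<open>m\<close> by their gcd scales the congruence and
  its modulus alike; the cofactor of \<open>x\<close> left over is invertible modulo
  \<open>m div gcd x m\<close>.\<close>

lemma cong_mult_rcancel_gcd:
  fixes a b x m :: nat
  assumes "m > 0"
  shows "[a * x = b * x] (mod m) \<longleftrightarrow> [a = b] (mod m div gcd x m)"
proof -
  define g where "g = gcd x m"
  define x' where "x' = x div g"
  define m' where "m' = m div g"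
  have g: "g > 0" using assms by (simp add: g_def)
  have eq: "x = g * x'" "m = g * m'"
    by (simp_all add: x'_def m'_def g_def)
  have "coprime x' m'"
    using assms unfolding x'_def m'_def g_def by (intro div_gcd_coprime) simp
  have "[a * x = b * x] (mod m) \<longleftrightarrow> [a * x' = b * x'] (mod m')"
    using g by (simp add: cong_def eq mult.left_commute[of _ g] mult_mod_right[symmetric])
  also have "\<dots> \<longleftrightarrow> [a = b] (mod m')"
    using \<open>coprime x' m'\<close> by (rule cong_mult_rcancel_nat)
  finally show ?thesis by (simp add: m'_def g_def)
qed

text \<open>With \<open>d = m div gcd x m\<close>, cancelling \<open>x\<close> shows that the
  exponents \<open>i\<close> and \<open>j\<close> give the same element exactly when they agree
  modulo \<open>h d\<close>, so the exponents below \<open>h d\<close> enumerate the coset without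
  repetition.\<close>

lemma card_cyclotomic_coset:
  fixes m x :: nat
  assumes "odd m" "x < m"
  shows "card (orbit (\<lambda>y. 2 * y mod m) x) = h (m div gcd x m)"
proof -
  define d where "d = m div gcd x m"
  have "d dvd m" unfolding d_def by (rule dvdI[of _ _ "gcd x m"]) simp
  then have "odd d" using assms(1) dvd_trans by blast
  then have cop: "coprime d 2" by simp
  then have pos: "h d > 0" by (simp add: h_def ord_eq_0)
  have iff: "2 ^ i * x mod m = 2 ^ j * x mod m \<longleftrightarrow> i mod h d = j mod h d" for i j
    using cong_mult_rcancel_gcd[of m "2 ^ i" x "2 ^ j"] order_divides_expdiff[OF cop, of i j] assms
    by (simp add: d_def h_def cong_def)
  have "orbit (\<lambda>y. 2 * y mod m) x = (\<lambda>i. 2 ^ i * x mod m) ` {..<h d}"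
  proof -
    have "2 ^ i * x mod m \<in> (\<lambda>i. 2 ^ i * x mod m) ` {..<h d}" for i
      by (rule image_eqI[of _ _ "i mod h d"]) (use pos in \<open>simp_all add: iff\<close>)
    then show ?thesis
      unfolding cyclotomic_coset_eq[OF assms] by auto
  qed
  moreover have "inj_on (\<lambda>i. 2 ^ i * x mod m) {..<h d}"
    by (auto simp: inj_on_def iff)
  ultimately show ?thesis by (simp add: card_image d_def)
qed

lemma self_in_cyclotomic_coset:
  fixes m x :: nat
  assumes "odd m" "x < m"
  shows "x \<in> orbit (\<lambda>y. 2 * y mod m) x"
  unfolding cyclotomic_coset_eq[OF assms] using assms(2) by (auto intro!: exI[of _ 0])

text \<open>Powers of 2 are invertible modulo the odd \<open>m\<close>, so they never send a nonzero
  residue to 0.\<close>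

lemma cyclotomic_coset_subset:
  fixes m x :: nat
  assumes "odd m" "x \<in> {1..m - 1}"
  shows "orbit (\<lambda>y. 2 * y mod m) x \<subseteq> {1..m - 1}"
proof -
  have x: "0 < x" "x < m" using assms(2) by auto
  have "0 < 2 ^ i * x mod m \<and> 2 ^ i * x mod m < m" for i
  proof -
    have "coprime m (2 ^ i)" using assms(1) by simp
    then have "\<not> m dvd 2 ^ i * x"
      using x by (simp add: coprime_dvd_mult_right_iff nat_dvd_not_less)
    then show ?thesis using x by (simp add: dvd_eq_mod_eq_0)
  qed
  then have "2 ^ i * x mod m \<in> {1..m - 1}" for i
    unfolding atLeastAtMost_iff by (metis One_nat_def Suc_leI Suc_pred less_Suc_eq_le gr_zeroI not_less_zero)
  then show ?thesis
    unfolding cyclotomic_coset_eq[OF assms(1) x(2)] by blast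
qed

lemma Union_cyclotomic_cosets:
  assumes "odd m"
  shows "\<Union>(cyclotomic_cosets m) = {1..m - 1}"
proof
  show "\<Union>(cyclotomic_cosets m) \<subseteq> {1..m - 1}"
    unfolding cyclotomic_cosets_def using cyclotomic_coset_subset[OF assms] by blast
  show "{1..m - 1} \<subseteq> \<Union>(cyclotomic_cosets m)"
  proof
    fix x assume "x \<in> {1..m - 1}"
    moreover from this have "x < m" by auto
    ultimately show "x \<in> \<Union>(cyclotomic_cosets m)"
      unfolding cyclotomic_cosets_def using self_in_cyclotomic_coset[OF assms] by blast
  qed
qed

text \<open>Since \<open>x\<close> lies in its own orbit, that orbit is cyclic and is also the orbit
  of each of its points. A common point therefore forces two cosets to coincide.\<close>

lemma disjoint_cyclotomic_cosets:
  assumes "odd m"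
  shows "pairwise disjnt (cyclotomic_cosets m)"
proof (rule pairwiseI)
  fix A B assume AB: "A \<in> cyclotomic_cosets m" "B \<in> cyclotomic_cosets m" "A \<noteq> B"
  let ?O = "orbit (\<lambda>y. 2 * y mod m)"
  have eq: "?O z = C" if "C \<in> cyclotomic_cosets m" "z \<in> C" for C z
  proof -
    from that(1) obtain x where x: "x \<in> {1..m - 1}" "C = ?O x"
      by (auto simp: cyclotomic_cosets_def)
    from x(1) have "x < m" by auto
    then have "x \<in> ?O x" using assms by (rule self_in_cyclotomic_coset[rotated])
    then have "cyclic_on (\<lambda>y. 2 * y mod m) C"
      using x(2) by (intro cyclic_on_singleI) auto
    then show ?thesis using that(2) by (rule orbit_cyclic_eq3)
  qed
  show "disjnt A B"
    using eq[OF AB(1)] eq[OF AB(2)] AB(3) by (auto simp: disjnt_iff)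
qed

lemma sum_card_cyclotomic_cosets:
  assumes "odd m"
  shows "sum card (cyclotomic_cosets m) = m - 1"
proof -
  have "finite A" if "A \<in> cyclotomic_cosets m" for A
    using that Union_cyclotomic_cosets[OF assms] finite_subset[of A "{1..m - 1}"] by blast
  then show ?thesis
    using card_Union_disjoint[OF disjoint_cyclotomic_cosets[OF assms]]
      Union_cyclotomic_cosets[OF assms] by simp
qed

lemma overpseudoprime_iff:
  "overpseudoprime m \<longleftrightarrow>
     odd m \<and> m > 1 \<and> \<not> prime m \<and> (\<forall>d. d dvd m \<and> d > 1 \<longrightarrow> h d = h m)"
proof (cases "odd m \<and> m > 1")
  case True
  then have m: "odd m" "m > 1" by auto
  let ?O = "orbit (\<lambda>y. 2 * y mod m)"
  have fin: "finite (cyclotomic_cosets m)" by (simp add: cyclotomic_cosets_def)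
  have hpos: "h m > 0" using m by (simp add: h_def ord_eq_0)
  have card: "card (?O x) = h (m div gcd x m)" if "x \<in> {1..m - 1}" for x
    using card_cyclotomic_coset[OF m(1), of x] that m(2) by auto
  have le: "card A \<le> h m" if A: "A \<in> cyclotomic_cosets m" for A
  proof -
    obtain x where "x \<in> {1..m - 1}" "A = ?O x"
      using A unfolding cyclotomic_cosets_def by blast
    moreover have "h (m div gcd x m) dvd h m"
      unfolding h_def by (rule ord_dvd_mono, rule dvdI[of _ _ "gcd x m"]) simp
    ultimately show ?thesis using card hpos by (simp add: dvd_imp_le)
  qed
  \<comment> \<open>The coset sizes add up to \<open>m - 1\<close>, while \<open>r m * h m\<close>
    is a constant sum over the same cosets.\<close>
  have "m = r m * h m + 1 \<longleftrightarrow> sum card (cyclotomic_cosets m) = (\<Sum>A\<in>cyclotomic_cosets m. h m)"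
    using sum_card_cyclotomic_cosets[OF m(1)] m(2) by (auto simp: r_def)
  \<comment> \<open>By \<open>le\<close> no term on the left exceeds its counterpart, so equal
    totals force equality term by term.\<close>
  also have "\<dots> \<longleftrightarrow> (\<forall>A\<in>cyclotomic_cosets m. card A = h m)"
    using sum_mono_inv[of card "cyclotomic_cosets m" "\<lambda>_. h m"] le fin
    by (metis sum.cong)
  also have "\<dots> \<longleftrightarrow> (\<forall>x\<in>{1..m - 1}. h (m div gcd x m) = h m)"
    using card by (simp add: cyclotomic_cosets_def)
  also have "\<dots> \<longleftrightarrow> (\<forall>d. d dvd m \<and> d > 1 \<longrightarrow> h d = h m)"
  proof (intro iffI allI ballI impI)
    fix d assume H: "\<forall>x\<in>{1..m - 1}. h (m div gcd x m) = h m" and d: "d dvd m \<and> d > 1"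
    then obtain e where e: "m = d * e" by blast
    \<comment> \<open>The cofactor \<open>e\<close> serves as the residue:
      \<open>gcd e m = e\<close>, so \<open>m div gcd e m\<close> is exactly \<open>d\<close>, and
      \<open>d > 1\<close> keeps \<open>e\<close> below \<open>m\<close>.\<close>
    with m d have "0 < e" "e < m" by (auto intro: Nat.gr0I)
    with H have "h (m div gcd e m) = h m" by auto
    with e \<open>0 < e\<close> show "h d = h m" by simp
  next
    fix x assume H: "\<forall>d. d dvd m \<and> d > 1 \<longrightarrow> h d = h m" and x: "x \<in> {1..m - 1}"
    have "gcd x m \<le> x" using x by (intro gcd_le1_nat) auto
    also have "x < m" using x by auto
    finally have "gcd x m < m" .
    moreover have "m = gcd x m * (m div gcd x m)" by simp
    ultimately have "m div gcd x m > 1"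
      using m(2) by (metis less_one linorder_neqE_nat mult.right_neutral mult_0_right
          nat_neq_iff not_less_zero)
    moreover have "m div gcd x m dvd m" by (rule dvdI[of _ _ "gcd x m"]) simp
    ultimately show "h (m div gcd x m) = h m" using H by blast
  qed
  finally show ?thesis by (simp add: overpseudoprime_def m)
qed (auto simp: overpseudoprime_def)

theorem theorem3:
  fixes k :: nat and p l :: "nat \<Rightarrow> nat"
  assumes "k \<ge> 1"
    and "\<forall>i\<in>{1..k}. prime (p i) \<and> odd (p i)"
    and "inj_on p {1..k}"
    and "\<forall>i\<in>{1..k}. l i > 0"
    and "\<forall>i\<in>{1..k}. overpseudoprime (p i ^ l i)"
    and "\<forall>i\<in>{1..k}. \<forall>j\<in>{1..k}. h (p i) = h (p j)"
  shows "overpseudoprime (\<Prod>i = 1..k. p i ^ l i)"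
proof -
  define n where "n = (\<Prod>i = 1..k. p i ^ l i)"
  define H where "H = h (p 1)"
  have one: "1 \<in> {1..k}" using assms(1) by simp
  have hp: "h (p i) = H" if "i \<in> {1..k}" for i
    using assms(6) one that unfolding H_def by blast
  have hpl: "h (p i ^ l i) = H" if "i \<in> {1..k}" for i
  proof -
    \<comment> \<open>The characterisation is applied to the divisor \<open>p i\<close> of the
      overpseudoprime \<open>p i ^ l i\<close>.\<close>
    have "p i dvd p i ^ l i" "p i > 1"
      using assms(2,4) that by (auto simp: prime_gt_Suc_0_nat)
    then have "h (p i) = h (p i ^ l i)"
      using assms(5) that overpseudoprime_iff by blast
    then show ?thesis using hp that by simp
  qed
  \<comment> \<open>The congruence holds modulo each prime power, and these are pairwise coprime
    because \<open>p\<close> is injective.\<close>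
  have "[2 ^ H = 1] (mod n)"
    unfolding n_def
  proof (rule coprime_cong_prod_nat)
    fix i assume "i \<in> {1..k}"
    then show "[2 ^ H = 1] (mod p i ^ l i)"
      using hpl[of i] by (simp only: ord_divides) (simp add: h_def)
  next
    fix i j assume "i \<in> {1..k}" "j \<in> {1..k}" "i \<noteq> j"
    then have "coprime (p i) (p j)"
      using assms(2,3) by (intro primes_coprime) (auto dest: inj_onD)
    then show "coprime (p i ^ l i) (p j ^ l j)" by simp
  qed
  then have upper: "h n dvd H" by (simp only: ord_divides h_def)
  \<comment> \<open>The case \<open>d = n\<close> gives \<open>h n = H\<close>, so this is the
    divisor condition of \<open>overpseudoprime_iff\<close>.\<close>
  have hd: "h d = H" if "d dvd n" "d > 1" for d
  proof -
    obtain q where q: "prime q" "q dvd d" using \<open>d > 1\<close> prime_factor_nat[of d] by auto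
    then have "q dvd n" using \<open>d dvd n\<close> dvd_trans by blast
    then obtain i where i: "i \<in> {1..k}" "q dvd p i ^ l i"
      using q(1) unfolding n_def by (auto simp: prime_dvd_prod_iff)
    then have "q = p i"
      using q(1) assms(2) by (metis prime_dvd_power primes_dvd_imp_eq)
    then have "H dvd h d"
      using ord_dvd_mono[OF q(2), of 2] hp[OF i(1)] by (simp add: h_def)
    moreover have "h d dvd H"
      using dvd_trans[OF ord_dvd_mono[OF \<open>d dvd n\<close>, of 2]] upper by (simp add: h_def)
    ultimately show ?thesis by (simp add: dvd_antisym)
  qed
  have odd: "odd n" unfolding n_def using assms(2) by (auto simp: even_prod_iff)
  \<comment> \<open>Compositeness, including the case \<open>k = 1\<close>, is inherited from the
    first factor: a prime has no composite divisor.\<close>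
  have dvd1: "p 1 ^ l 1 dvd n" unfolding n_def using one by (intro dvd_prodI) auto
  have comp: "p 1 ^ l 1 > 1" "\<not> prime (p 1 ^ l 1)"
    using assms(5) one overpseudoprime_iff by blast+
  have "n > 0" using odd by (rule odd_pos)
  then have n1: "n > 1" using dvd_imp_le[OF dvd1] comp(1) by linarith
  have "\<not> prime n" using dvd1 comp by (metis less_irrefl prime_nat_iff)
  then have "overpseudoprime n" using odd n1 hd by (simp add: overpseudoprime_iff)
  then show ?thesis by (simp add: n_def)
qed

end
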